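(* Let $x^*\in\mathbb{S}^{d-1}$ be a fixed target vector, let $r\ge 1$, $0<\mu\le 1$, $0<\bar\theta<\pi/2$, and let $x^0\in\mathbb{S}^{d-1}$ satisfy $\theta(x^0,x^* )\le\bar\theta$. Let $g$ be a tangent vector field on the sphere, $g(x)\in \mathrm{T}_x\mathbb{S}^{d-1}$, and let $x^1,\dots,x^K$ be generated by Riemannian Gradient Descent $$x^{k+1}=\frac{x^k-\eta_k g(x^k)}{\|x^k-\eta_k g(x^k)\|_2},\qquad k=0,\dots,K-1 .$$ Write $\theta_k=\theta(x^k,x^* )$. Suppose that $g$ is $(\mu,r)$-RGA at $(x^k,x^* )$ for all $k=0,\dots,K$. 1. If $r=1$ and $\eta_k=\sin(\bar\theta/2)\,\mu\,(1-\mu^2/8)^k/\|g(x^k)\|_2$, then for all $0\le k\le K$ $$\tfrac12\|x^k-x^*\|_2=\sin(\theta_k/2)\le \sin(\bar\theta/2)\exp\Big(-\frac{\mu^2k}{8}\Big).$$ 2. If $r>1$, let $\bar k=\Big\lfloor \dfrac{4}{(r-1)\mu^2(\sin(\bar\theta/2)/2)^{2(r-1)}}\Big\rfloor-1$ and $$\eta_k=\begin{cases}\dfrac{\mu\,\sin^r(\bar\theta/2)}{\|g(x^k)\|_2}, & k\le \bar k-1,\\[2mm] \Big(\dfrac{4}{\mu^2(r-1)(k+1)}\Big)^{r/(2r-2)}\dfrac{\mu}{\|g(x^k)\|_2}, & k\ge\bar k.\end{cases}$$ Then for all $0\le k\le K$ $$\tfrac12\|x^k-x^*\|_2=\sin(\theta_k/2)\le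 \min\Big\{2\Big(\frac{4}{\mu^2(r-1)}\cdot\frac1{k+1}\Big)^{\frac1{2(r-1)}},\ \sin(\bar\theta/2)\Big\}.$$
   Context: $\mathbb{S}^{d-1}$ is the Euclidean unit sphere in $\mathbb{R}^d$; $\mathrm{T}_x\mathbb{S}^{d-1}=\{y\in\mathbb{R}^d: y\perp x\}$; $\theta(x,y)=\arccos(x\cdot y)$ for unit vectors. A tangent vector field $g$ is $(\mu,r)$-RGA (Riemannian Gradient Alignment) at $(x,x^* )$ if $g(x)\ne 0$ whenever $x\ne x^*$, and $g(x)\cdot x^*\le -\mu\,\sin^r(\theta(x,x^* ))\,\|g(x)\|_2$. Convention: if $g(x^k)=0$ (which under RGA is possible only when $x^k=x^*$), the iteration stays put, $x^{k+1}=x^k$. *)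

theory Defs
  imports "HOL-Analysis.Analysis"
begin

definition sphere_angle :: "real ^ 'n \<Rightarrow> real ^ 'n \<Rightarrow> real" where
  "sphere_angle x y = arccos (x \<bullet> y)"

definition tangent_space :: "real ^ 'n \<Rightarrow> (real ^ 'n) set" where
  "tangent_space x = {y. orthogonal y x}"

text \<open>Vector fields are total functions on the ambient space; only their values on the unit
  sphere are constrained.\<close>

definition tangent_vector_field :: "(real ^ 'n \<Rightarrow> real ^ 'n) \<Rightarrow> bool" where
  "tangent_vector_field g \<longleftrightarrow> (\<forall>x \<in> sphere 0 1. g x \<in> tangent_space x)"

text \<open>Riemannian Gradient Alignment. The exponent is real; the base of \<open>powr\<close> is nonnegative
  because \<open>sphere_angle\<close> takes values in \<open>[0, pi]\<close> on unit vectors, and \<open>0 powr r = 0\<close> agrees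
  with the usual convention for \<open>r > 0\<close>.\<close>

definition RGA ::
  "real \<Rightarrow> real \<Rightarrow> (real ^ 'n \<Rightarrow> real ^ 'n) \<Rightarrow> real ^ 'n \<Rightarrow> real ^ 'n \<Rightarrow> bool" where
  "RGA \<mu> r g x xs \<longleftrightarrow>
     (x \<noteq> xs \<longrightarrow> g x \<noteq> 0) \<and>
     g x \<bullet> xs \<le> - \<mu> * sin (sphere_angle x xs) powr r * norm (g x)"

text \<open>When \<open>g (x k) = 0\<close> the iteration stays put whatever the value of \<open>\<eta> k\<close>. In particular,
  for step sizes of the form \<open>c / norm (g (x k))\<close> the value of division by zero is irrelevant.\<close>

definition rgd_iterates ::
  "(real ^ 'n \<Rightarrow> real ^ 'n) \<Rightarrow> (nat \<Rightarrow> real) \<Rightarrow> nat \<Rightarrow> (nat \<Rightarrow> real ^ 'n) \<Rightarrow> bool" where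
  "rgd_iterates g \<eta> K x \<longleftrightarrow>
     (\<forall>k<K. x (Suc k) =
        (if g (x k) = 0 then x k
         else (x k - \<eta> k *\<^sub>R g (x k)) /\<^sub>R norm (x k - \<eta> k *\<^sub>R g (x k))))"

end

theory Submission
  imports Defs
begin

text \<open>
  Write \<open>s k = sin (\<theta> k / 2) = norm (x k - xs) / 2\<close> and let \<open>t k = \<eta> k * norm (g (x k))\<close> be the
  length of the tangential step. Since \<open>g (x k)\<close> is orthogonal to \<open>x k\<close>, the point
  \<open>x k - \<eta> k *\<^sub>R g (x k)\<close> lies outside the open unit ball, so that normalising it cannot increase
  its distance to the unit vector \<open>xs\<close>. Expanding the square, and using the alignment condition
  together with \<open>sin \<theta> \<ge> sqrt 2 * sin (\<theta> / 2)\<close> for \<open>\<theta> \<le> pi / 2\<close>, gives the recursion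
  (lemma \<open>rgd_step\<close>)
  \<open>(s (k + 1))\<^sup>2 \<le> (s k)\<^sup>2 - t k * \<mu> / 2 * (sqrt 2 * s k) powr r + (t k)\<^sup>2 / 4\<close>.

  All three prescribed step sizes have the form \<open>t = \<mu> * R powr r\<close>, where \<open>R\<close> is the current
  reference radius. Writing \<open>s = a * R\<close> and \<open>b = \<mu>\<^sup>2 * R powr (2 * (r - 1))\<close>, the right-hand side is
  \<open>R\<^sup>2\<close> times the scalar \<open>a\<^sup>2 - b / 2 * (sqrt 2 * a) powr r + b / 4\<close> (lemma \<open>step_bound_rescaled\<close>).
  It remains to bound this scalar. For \<open>r = 1\<close>, with the geometric radius
  \<open>R k = sin (\<theta>bar / 2) * (1 - \<mu>\<^sup>2 / 8) ^ k\<close> and \<open>a \<le> 1\<close>, it is at most \<open>(1 - \<mu>\<^sup>2 / 8)\<^sup>2\<close>, so that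
  \<open>s k \<le> R k\<close> is propagated. For \<open>r > 1\<close>, with the constant radius \<open>R = sin (\<theta>bar / 2)\<close> and \<open>a \<le> 1\<close>, it
  is at most 1, so the initial bound is preserved. With the radius
  \<open>R k = (4 / (\<mu>\<^sup>2 * (r - 1) * (k + 1))) powr (1 / (2 * (r - 1)))\<close> it is, for \<open>a \<le> 2\<close>, at most
  \<open>4 * (1 - h)\<close>, where \<open>h = 1 / ((r - 1) * (k + 1))\<close>; since \<open>(R (k + 1) / R k)\<^sup>2 \<ge> 1 - h\<close>, the bound
  \<open>s k \<le> 2 * R k\<close> is propagated. The smallness \<open>h \<le> 1 / 4\<close> needed here holds because this
  regime is entered only once \<open>2 * R (k + 1) < sin (\<theta>bar / 2)\<close>, which forces
  \<open>(r - 1) * (k + 1) \<ge> 4\<close>. The switching index \<open>kbar\<close> is the last \<open>k\<close> for which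
  \<open>sin (\<theta>bar / 2) \<le> 2 * R k\<close>, so the radius is changed precisely when the decreasing bound becomes
  the smaller one.
\<close>

section \<open>One step of Riemannian gradient descent\<close>

lemma sin_half_sphere_angle:
  fixes x y :: "real ^ 'n"
  assumes "norm x = 1" "norm y = 1"
  shows "sin (sphere_angle x y / 2) = norm (x - y) / 2"
proof -
  have b: "\<bar>x \<bullet> y\<bar> \<le> 1"
    using Cauchy_Schwarz_ineq2[of x y] assms by simp
  have nrm: "(norm (x - y))\<^sup>2 = 2 - 2 * (x \<bullet> y)"
    using assms by (simp add: power2_norm_eq_inner inner_diff inner_commute norm_eq_1)
  have c: "cos (sphere_angle x y) = x \<bullet> y"
    unfolding sphere_angle_def using b by (simp add: cos_arccos_abs)
  have "cos (sphere_angle x y) = 1 - 2 * (sin (sphere_angle x y / 2))\<^sup>2"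
    using cos_double_sin[of "sphere_angle x y / 2"] by simp
  hence sq: "(sin (sphere_angle x y / 2))\<^sup>2 = (norm (x - y) / 2)\<^sup>2"
    using c nrm by (simp add: power_divide)
  have "0 \<le> sphere_angle x y" "sphere_angle x y \<le> pi"
    unfolding sphere_angle_def using b arccos_lbound arccos_ubound by (auto simp: abs_le_iff)
  hence "0 \<le> sin (sphere_angle x y / 2)"
    by (intro sin_ge_zero) auto
  with sq show ?thesis by (rule power2_eq_imp_eq) simp
qed

lemma sin_sphere_angle_ge:
  fixes x y :: "real ^ 'n"
  assumes "norm x = 1" "norm y = 1" and small: "(norm (x - y) / 2)\<^sup>2 \<le> 1 / 2"
  shows "sqrt 2 * (norm (x - y) / 2) \<le> sin (sphere_angle x y)"
proof -
  define s where "s = norm (x - y) / 2"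
  have s: "sin (sphere_angle x y / 2) = s" "0 \<le> s"
    using sin_half_sphere_angle[OF assms(1,2)] by (auto simp: s_def)
  have b: "\<bar>x \<bullet> y\<bar> \<le> 1"
    using Cauchy_Schwarz_ineq2[of x y] assms by simp
  have "0 \<le> sphere_angle x y" "sphere_angle x y \<le> pi"
    unfolding sphere_angle_def using b arccos_lbound arccos_ubound by (auto simp: abs_le_iff)
  hence c0: "0 \<le> cos (sphere_angle x y / 2)"
    by (intro cos_ge_zero) auto
  have "1 / 2 \<le> (cos (sphere_angle x y / 2))\<^sup>2"
    unfolding cos_squared_eq s(1) using small[folded s_def] by linarith
  hence "2 \<le> (2 * cos (sphere_angle x y / 2))\<^sup>2"
    by (simp add: power_mult_distrib)
  hence "sqrt 2 \<le> 2 * cos (sphere_angle x y / 2)"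
    using c0 by (intro real_le_lsqrt) auto
  hence "sqrt 2 * s \<le> 2 * cos (sphere_angle x y / 2) * s"
    using s(2) by (rule mult_right_mono)
  also have "\<dots> = sin (sphere_angle x y)"
    using sin_double[of "sphere_angle x y / 2"] s(1) by simp
  finally show ?thesis by (simp add: s_def)
qed

lemma norm_normalize_diff_le:
  fixes y z :: "'a :: real_inner"
  assumes y: "1 \<le> norm y" and z: "norm z = 1"
  shows "norm (y /\<^sub>R norm y - z) \<le> norm (y - z)"
proof -
  define n where "n = norm y"
  define q where "q = (y \<bullet> z) / n"
  have n: "1 \<le> n" using y by (simp add: n_def)
  have "y \<bullet> z \<le> n" using Cauchy_Schwarz_ineq2[of y z] z by (simp add: n_def)
  hence q: "q \<le> 1" using n by (simp add: q_def)
  have yz: "y \<bullet> z = n * q" using n by (simp add: q_def)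
  have zz: "z \<bullet> z = 1" using z by (simp add: norm_eq_1)
  have yy: "y \<bullet> y = n\<^sup>2" by (simp add: n_def power2_norm_eq_inner)
  have e1: "(norm (y - z))\<^sup>2 = n\<^sup>2 - 2 * (n * q) + 1"
    by (simp add: power2_norm_eq_inner inner_diff inner_commute[of z y] yz zz yy)
  have e2: "(norm (y /\<^sub>R norm y - z))\<^sup>2 = 2 - 2 * q"
    unfolding n_def[symmetric] power2_norm_eq_inner
    using n by (simp add: inner_diff inner_commute[of z y] yz zz yy power2_eq_square field_simps)
  have "0 \<le> (n - 1) * (n + 1 - 2 * q)"
    using n q by (intro mult_nonneg_nonneg) auto
  hence "(norm (y /\<^sub>R norm y - z))\<^sup>2 \<le> (norm (y - z))\<^sup>2"
    unfolding e1 e2 by (simp add: algebra_simps power2_eq_square)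
  thus ?thesis by (rule power2_le_imp_le) simp
qed

lemma norm_tangent_step_ge_1:
  fixes x v :: "'a :: real_inner"
  assumes "norm x = 1" "v \<bullet> x = 0"
  shows "1 \<le> norm (x - c *\<^sub>R v)"
proof -
  have "(norm (x - c *\<^sub>R v))\<^sup>2 = 1 + (norm (c *\<^sub>R v))\<^sup>2"
    using assms unfolding power2_norm_eq_inner
    by (simp add: inner_diff inner_commute[of x v] norm_eq_1)
  hence "1\<^sup>2 \<le> (norm (x - c *\<^sub>R v))\<^sup>2" by simp
  thus ?thesis by (rule power2_le_imp_le) simp
qed

lemma rgd_step:
  fixes x xs :: "real ^ 'n" and g :: "real ^ 'n \<Rightarrow> real ^ 'n"
  assumes x: "norm x = 1" and xs: "norm xs = 1"
    and tang: "g x \<bullet> x = 0" and rga: "RGA \<mu> r g x xs"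
    and pos: "0 \<le> \<eta>" "0 \<le> \<mu>" "0 \<le> r"
    and small: "(norm (x - xs) / 2)\<^sup>2 \<le> 1 / 2"
  defines "y \<equiv> x - \<eta> *\<^sub>R g x"
  defines "t \<equiv> \<eta> * norm (g x)"
  shows "(norm (y /\<^sub>R norm y - xs) / 2)\<^sup>2 \<le>
    (norm (x - xs) / 2)\<^sup>2 - t * \<mu> / 2 * (sqrt 2 * (norm (x - xs) / 2)) powr r + t\<^sup>2 / 4"
proof -
  let ?P = "(sqrt 2 * (norm (x - xs) / 2)) powr r"
  have "g x \<bullet> xs \<le> - \<mu> * sin (sphere_angle x xs) powr r * norm (g x)"
    using rga by (simp add: RGA_def)
  also have "\<dots> \<le> - \<mu> * ?P * norm (g x)"
  proof -
    have "?P \<le> sin (sphere_angle x xs) powr r"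
      using sin_sphere_angle_ge[OF x xs small] pos by (intro powr_mono2) auto
    hence "\<mu> * ?P * norm (g x) \<le> \<mu> * sin (sphere_angle x xs) powr r * norm (g x)"
      using pos by (intro mult_right_mono mult_left_mono) auto
    thus ?thesis by simp
  qed
  finally have "\<eta> * (g x \<bullet> xs) \<le> \<eta> * (- \<mu> * ?P * norm (g x))"
    using pos(1) by (rule mult_left_mono)
  hence align: "\<eta> * (g x \<bullet> xs) \<le> - (t * \<mu> * ?P)"
    by (simp add: t_def mult_ac)
  have "y - xs = (x - xs) - \<eta> *\<^sub>R g x" by (simp add: y_def)
  also have "(norm \<dots>)\<^sup>2 = (norm (x - xs))\<^sup>2 + 2 * (\<eta> * (g x \<bullet> xs)) + t\<^sup>2"
    using tang unfolding t_def power_mult_distrib power2_norm_eq_inner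
    by (simp add: inner_diff inner_commute[of x "g x"] inner_commute[of xs "g x"]
        algebra_simps power2_eq_square)
  finally have "(norm (y - xs))\<^sup>2 = (norm (x - xs))\<^sup>2 + 2 * (\<eta> * (g x \<bullet> xs)) + t\<^sup>2" .
  moreover have "(norm (y /\<^sub>R norm y - xs))\<^sup>2 \<le> (norm (y - xs))\<^sup>2"
    using norm_normalize_diff_le[OF norm_tangent_step_ge_1[OF x tang] xs] unfolding y_def
    by (intro power_mono) auto
  ultimately have "(norm (y /\<^sub>R norm y - xs))\<^sup>2 \<le> (norm (x - xs))\<^sup>2 - 2 * (t * \<mu> * ?P) + t\<^sup>2"
    using align by linarith
  thus ?thesis by (simp add: power_divide mult_ac)
qed

lemma rgd_iterates_on_sphere:
  fixes x :: "nat \<Rightarrow> real ^ 'n"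
  assumes "rgd_iterates g \<eta> K x" "tangent_vector_field g" "norm (x 0) = 1" "k \<le> K"
  shows "norm (x k) = 1"
  using assms(4)
proof (induction k)
  case (Suc k)
  hence x: "norm (x k) = 1" by simp
  have "g (x k) \<bullet> x k = 0"
    using assms(2) x by (auto simp: tangent_vector_field_def tangent_space_def orthogonal_def)
  hence "1 \<le> norm (x k - \<eta> k *\<^sub>R g (x k))"
    by (rule norm_tangent_step_ge_1[OF x])
  hence "x k - \<eta> k *\<^sub>R g (x k) \<noteq> 0" by auto
  thus ?case using assms(1) Suc.prems x by (simp add: rgd_iterates_def)
qed (use assms in simp)

section \<open>The scalar recursion\<close>

lemma step_bound_rescaled:
  fixes a R \<mu> r :: real
  assumes "0 \<le> a" "0 < R"
  defines "b \<equiv> \<mu>\<^sup>2 * R powr (2 * (r - 1))" and "t \<equiv> \<mu> * R powr r"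
  shows "(a * R)\<^sup>2 - t * \<mu> / 2 * (sqrt 2 * (a * R)) powr r + t\<^sup>2 / 4
       = R\<^sup>2 * (a\<^sup>2 - b / 2 * (sqrt 2 * a) powr r + b / 4)"
proof -
  have "(sqrt 2 * (a * R)) powr r = (sqrt 2 * a) powr r * R powr r"
    using assms by (simp add: powr_mult mult.assoc[symmetric])
  moreover have "R powr r * R powr r = R\<^sup>2 * R powr (2 * (r - 1))"
  proof -
    have "R\<^sup>2 = R powr 2" using assms(2) by simp
    thus ?thesis by (simp add: powr_add[symmetric])
  qed
  ultimately show ?thesis
    unfolding b_def t_def by (simp add: power2_eq_square algebra_simps)
qed

lemma scalar_bound_linear:
  fixes a b :: real
  assumes "0 \<le> a" "a \<le> 1" "0 \<le> b" "b \<le> 1"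
  shows "a\<^sup>2 - b / 2 * (sqrt 2 * a) powr 1 + b / 4 \<le> (1 - b / 8)\<^sup>2"
proof -
  have "1 \<le> sqrt 2" by simp
  hence "b / 2 * a \<le> b / 2 * (sqrt 2 * a)"
    using assms by (intro mult_left_mono) (auto simp: mult_le_cancel_right1)
  moreover have "0 \<le> (1 - a) * (1 + a - b / 2)"
    using assms by (intro mult_nonneg_nonneg) auto
  hence "a\<^sup>2 - b / 2 * a + b / 4 \<le> 1 - b / 4"
    by (simp add: power2_eq_square field_simps)
  moreover have "(1 - b / 8)\<^sup>2 = 1 - b / 4 + (b / 8)\<^sup>2"
    by (simp add: power2_eq_square algebra_simps)
  moreover have "(sqrt 2 * a) powr 1 = sqrt 2 * a" using assms by simp
  ultimately show ?thesis
    using zero_le_power2[of "b / 8"] by (smt (verit))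
qed

lemma scalar_bound_constant:
  fixes a b r :: real
  assumes "0 \<le> a" "a \<le> 1" "0 \<le> b" "b \<le> 1" "0 \<le> r"
  shows "a\<^sup>2 - b / 2 * (sqrt 2 * a) powr r + b / 4 \<le> 1"
proof (cases "1 \<le> sqrt 2 * a")
  case True
  hence "1 \<le> (sqrt 2 * a) powr r"
    using assms by (intro ge_one_powr_ge_zero) auto
  hence "b / 2 * 1 \<le> b / 2 * (sqrt 2 * a) powr r"
    using assms by (intro mult_left_mono) auto
  moreover have "a\<^sup>2 \<le> 1" using assms by (simp add: power_le_one)
  ultimately show ?thesis using assms by simp
next
  case False
  hence "(sqrt 2 * a)\<^sup>2 \<le> 1"
    using assms by (intro power_le_one) auto
  hence "a\<^sup>2 \<le> 1 / 2" by (simp add: power_mult_distrib)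
  moreover have "0 \<le> b / 2 * (sqrt 2 * a) powr r" using assms by simp
  ultimately show ?thesis using assms by linarith
qed

lemma scalar_bound_decreasing:
  fixes a h r :: real
  assumes "0 \<le> a" "a \<le> 2" "0 \<le> h" "h \<le> 1 / 4" "1 \<le> r"
  shows "a\<^sup>2 - (4 * h) / 2 * (sqrt 2 * a) powr r + (4 * h) / 4 \<le> 4 * (1 - h)"
proof (cases "1 \<le> sqrt 2 * a")
  case True
  have "1.4 \<le> sqrt (2::real)" by (rule real_le_rsqrt) (simp add: power2_eq_square)
  hence "1.4 * a \<le> sqrt 2 * a" using assms by (intro mult_right_mono) auto
  also have "\<dots> \<le> (sqrt 2 * a) powr r"
    using powr_mono[of 1 r "sqrt 2 * a"] assms True by simp
  finally have "2 * h * (1.4 * a) \<le> 2 * h * (sqrt 2 * a) powr r"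
    using assms by (intro mult_left_mono) auto
  hence "2.8 * (h * a) \<le> 2 * h * (sqrt 2 * a) powr r" by simp
  \<comment> \<open>Replacing the exponent by 1 leaves a quadratic in \<open>a\<close>; factor out its distance to \<open>a = 2\<close>.\<close>
  moreover have "0 \<le> (2 - a) * (2 + a - 2.8 * h)"
    using assms by (intro mult_nonneg_nonneg) auto
  hence "a\<^sup>2 \<le> 4 - 5.6 * h + 2.8 * (h * a)"
    by (simp add: power2_eq_square field_simps)
  ultimately have "a\<^sup>2 - 2 * h * (sqrt 2 * a) powr r + h \<le> 4 * (1 - h)"
    using assms by argo
  thus ?thesis by simp
next
  case False
  hence "(sqrt 2 * a)\<^sup>2 \<le> 1"
    using assms by (intro power_le_one) auto
  hence "a\<^sup>2 \<le> 1 / 2" by (simp add: power_mult_distrib)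
  moreover have "0 \<le> h * (sqrt 2 * a) powr r" using assms by simp
  ultimately have "a\<^sup>2 - 2 * (h * (sqrt 2 * a) powr r) + h \<le> 4 * (1 - h)"
    using assms by argo
  thus ?thesis by simp
qed

text \<open>The hypothesis \<open>step\<close> of \<open>linear_rate_recursion\<close> and
  \<open>sublinear_rate_recursion\<close> allows \<open>s (Suc k) = 0\<close> as an alternative; this
  covers iterates with vanishing gradient, which have already reached the target.\<close>

lemma linear_rate_recursion:
  fixes s \<tau> :: "nat \<Rightarrow> real" and S \<mu> :: real
  assumes s0: "\<And>k. 0 \<le> s k" "s 0 \<le> S" and S: "0 < S" and \<mu>: "0 < \<mu>" "\<mu> \<le> 1"
    and step: "\<And>k. k < K \<Longrightarrow> s k \<le> S \<Longrightarrow> s (Suc k) = 0 \<or>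
      (s (Suc k))\<^sup>2 \<le> (s k)\<^sup>2 - \<tau> k * \<mu> / 2 * (sqrt 2 * s k) powr 1 + (\<tau> k)\<^sup>2 / 4"
    and \<tau>: "\<And>k. k < K \<Longrightarrow> \<tau> k = S * \<mu> * (1 - \<mu>\<^sup>2 / 8) ^ k"
    and k: "k \<le> K"
  shows "s k \<le> S * (1 - \<mu>\<^sup>2 / 8) ^ k"
  using k
proof (induction k)
  case (Suc k)
  define q where "q = 1 - \<mu>\<^sup>2 / 8"
  define R where "R = S * q ^ k"
  have m: "\<mu>\<^sup>2 \<le> 1" using \<mu> by (simp add: power_le_one)
  have q: "0 < q" "q \<le> 1" using m by (auto simp: q_def)
  have R: "0 < R" using S q by (simp add: R_def)
  have sR: "s k \<le> R" using Suc by (simp add: R_def q_def)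
  have "R \<le> S" using S q by (simp add: R_def mult_le_cancel_left1 power_le_one)
  from step[of k] this sR Suc.prems consider "s (Suc k) = 0" |
    "(s (Suc k))\<^sup>2 \<le> (s k)\<^sup>2 - \<tau> k * \<mu> / 2 * (sqrt 2 * s k) powr 1 + (\<tau> k)\<^sup>2 / 4"
    by fastforce
  thus ?case
  proof cases
    case 1
    thus ?thesis using S q by (simp flip: q_def)
  next
    case 2
    define a where "a = s k / R"
    have a: "0 \<le> a" "a \<le> 1" "s k = a * R"
      using R sR s0(1)[of k] by (auto simp: a_def)
    have \<tau>R: "\<tau> k = \<mu> * R powr 1"
      using \<tau>[of k] Suc.prems R by (simp add: R_def q_def)
    have "(s (Suc k))\<^sup>2 \<le> R\<^sup>2 * (a\<^sup>2 - \<mu>\<^sup>2 / 2 * (sqrt 2 * a) powr 1 + \<mu>\<^sup>2 / 4)"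
      using 2 step_bound_rescaled[OF a(1) R, of \<mu> 1] R unfolding \<tau>R a(3) by simp
    also have "\<dots> \<le> R\<^sup>2 * q\<^sup>2"
      unfolding q_def using scalar_bound_linear[OF a(1,2), of "\<mu>\<^sup>2"] m by (intro mult_left_mono) auto
    finally have "(s (Suc k))\<^sup>2 \<le> (R * q)\<^sup>2" by (simp add: power_mult_distrib)
    hence "s (Suc k) \<le> R * q"
      by (rule power2_le_imp_le) (use R q in simp)
    thus ?thesis by (simp add: R_def q_def mult_ac)
  qed
qed (use s0 in simp)

text \<open>The reference radius for \<open>r > 1\<close>, with \<open>A = 4 / (\<mu>\<^sup>2 * (r - 1))\<close> and \<open>u = r - 1\<close>.\<close>

definition sublinear_radius :: "real \<Rightarrow> real \<Rightarrow> nat \<Rightarrow> real" where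
  "sublinear_radius A u k = (A / (real k + 1)) powr (1 / (2 * u))"

lemma sublinear_radius_pos:
  assumes "0 < A"
  shows "0 < sublinear_radius A u k"
  using assms by (simp add: sublinear_radius_def add_pos_nonneg)

lemma sublinear_radius_powr:
  assumes "0 < A" "0 < u"
  shows "sublinear_radius A u k powr (2 * u) = A / (real k + 1)"
  using assms by (simp add: sublinear_radius_def powr_powr)

lemma le_sublinear_radius_iff:
  assumes "0 < A" "0 < u" "0 \<le> c"
  shows "c \<le> sublinear_radius A u k \<longleftrightarrow> c powr (2 * u) \<le> A / (real k + 1)"
proof -
  have "c \<le> sublinear_radius A u k \<longleftrightarrow> c powr (2 * u) \<le> sublinear_radius A u k powr (2 * u)"
    using assms sublinear_radius_pos[OF assms(1), of u k]
      powr_less_mono2[of "2 * u" "sublinear_radius A u k" c] powr_mono2[of "2 * u" c]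
    by (smt (verit))
  thus ?thesis using assms by (simp add: sublinear_radius_powr)
qed

lemma sublinear_radius_Suc_ge:
  assumes "0 < A" "0 < u"
  shows "(sublinear_radius A u k)\<^sup>2 * (1 - 1 / (u * (real k + 1))) \<le> (sublinear_radius A u (Suc k))\<^sup>2"
proof -
  define h where "h = 1 / (u * (real k + 1))"
  have sq: "(sublinear_radius A u j)\<^sup>2 = (A / (real j + 1)) powr (1 / u)" for j
    using assms by (simp add: sublinear_radius_def power2_eq_square powr_add[symmetric])
  have "ln ((real k + 2) / (real k + 1)) \<le> (real k + 2) / (real k + 1) - 1"
    by (intro ln_le_minus_one) (simp add: field_simps)
  also have "\<dots> = 1 / (real k + 1)" by (simp add: field_simps)
  finally have "1 / u * ln ((real k + 2) / (real k + 1)) \<le> 1 / u * (1 / (real k + 1))"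
    using assms by (intro mult_left_mono) auto
  hence "1 / u * ln ((real k + 2) / (real k + 1)) \<le> h" by (simp add: h_def)
  moreover have "ln ((real k + 1) / (real k + 2)) = - ln ((real k + 2) / (real k + 1))"
    by (simp add: ln_div)
  ultimately have "- h \<le> 1 / u * ln ((real k + 1) / (real k + 2))" by simp
  hence "exp (- h) \<le> ((real k + 1) / (real k + 2)) powr (1 / u)"
    by (simp add: powr_def)
  moreover have "1 - h \<le> exp (- h)" using exp_ge_add_one_self[of "- h"] by simp
  ultimately have le: "1 - h \<le> ((real k + 1) / (real k + 2)) powr (1 / u)" by linarith
  have "(A / (real k + 1)) powr (1 / u) * (1 - h)
      \<le> (A / (real k + 1)) powr (1 / u) * ((real k + 1) / (real k + 2)) powr (1 / u)"
    by (intro mult_left_mono le) simp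
  also have "\<dots> = (A / (real k + 1) * ((real k + 1) / (real k + 2))) powr (1 / u)"
    by (rule powr_mult[symmetric])
  also have "A / (real k + 1) * ((real k + 1) / (real k + 2)) = A / (real (Suc k) + 1)"
    by (simp add: add.commute)
  finally show ?thesis by (simp add: sq h_def)
qed

text \<open>For \<open>S \<le> 2 * R 0\<close> the bound \<open>4 / u\<close> would suffice; the sharper \<open>1 / (1 + u)\<close>, which follows from
  \<open>(S / 2)\<^sup>2 \<le> 1 / 8 \<le> exp (- 1)\<close>, is what gives \<open>h \<le> 1 / 4\<close> after the switch.\<close>

lemma half_radius_powr_le:
  fixes S u :: real
  assumes "0 < S" "S\<^sup>2 \<le> 1 / 2" "0 < u"
  shows "(S / 2) powr (2 * u) \<le> 1 / (1 + u)"
proof -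
  have "exp (1::real) * exp (- 1) = 1" by (simp flip: exp_add)
  moreover have "exp (1::real) * exp (- 1) \<le> 3 * exp (- 1)"
    using exp_le by (intro mult_right_mono) auto
  ultimately have e: "1 / 8 \<le> exp (- 1 :: real)" by linarith
  have "(S / 2) powr (2 * u) = ((S / 2)\<^sup>2) powr u"
    using assms by (simp add: powr_powr flip: powr_numeral)
  also have "\<dots> \<le> exp (- 1) powr u"
    using assms e by (intro powr_mono2) (auto simp: power_divide)
  also have "\<dots> = exp (- u)" by (simp add: powr_def)
  also have "\<dots> = 1 / exp u" by (simp add: exp_minus field_simps)
  also have "\<dots> \<le> 1 / (1 + u)"
    using assms exp_ge_add_one_self[of u] by (intro divide_left_mono) (auto simp: add_pos_pos)
  finally show ?thesis .
qed

text \<open>For \<open>k = 0\<close> the bound \<open>min (2 * R 0) S\<close> is just \<open>S\<close>: since \<open>S\<^sup>2 \<le> 1 / 2\<close>, the threshold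
  \<open>S \<le> 2 * R 0\<close> always holds (lemma \<open>half_radius_powr_le\<close>). The condition \<open>S \<le> 2 * R (Suc k)\<close>
  selecting the step size expresses \<open>k \<le> kbar - 1\<close> in terms of radii; see
  \<open>le_switching_index_iff\<close> below.\<close>

lemma sublinear_rate_recursion:
  fixes s \<tau> :: "nat \<Rightarrow> real" and S \<mu> r :: real
  assumes s0: "\<And>k. 0 \<le> s k" "s 0 \<le> S" and S: "0 < S" "S\<^sup>2 \<le> 1 / 2"
    and \<mu>: "0 < \<mu>" "\<mu> \<le> 1" and r: "1 < r"
    and step: "\<And>k. k < K \<Longrightarrow> s k \<le> S \<Longrightarrow> s (Suc k) = 0 \<or>
      (s (Suc k))\<^sup>2 \<le> (s k)\<^sup>2 - \<tau> k * \<mu> / 2 * (sqrt 2 * s k) powr r + (\<tau> k)\<^sup>2 / 4"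
  defines "R \<equiv> sublinear_radius (4 / (\<mu>\<^sup>2 * (r - 1))) (r - 1)"
  assumes \<tau>: "\<And>k. k < K \<Longrightarrow> \<tau> k = \<mu> * (if S \<le> 2 * R (Suc k) then S else R k) powr r"
    and k: "k \<le> K"
  shows "s k \<le> min (2 * R k) S"
  using k
proof (induction k)
  define u where "u = r - 1"
  define A where "A = 4 / (\<mu>\<^sup>2 * u)"
  have u: "0 < u" using r by (simp add: u_def)
  have m: "0 < \<mu>\<^sup>2" "\<mu>\<^sup>2 \<le> 1" using \<mu> by (auto simp: power_le_one)
  have A: "0 < A" using u m by (simp add: A_def)
  have Au: "4 / u \<le> A" unfolding A_def using u m
    by (intro divide_left_mono) (auto simp: mult_le_cancel_right1)
  have R: "R = sublinear_radius A u" by (simp add: R_def A_def u_def)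
  have Rpos: "0 < R j" for j by (simp add: R sublinear_radius_pos A)
  have iff: "S \<le> 2 * R j \<longleftrightarrow> (S / 2) powr (2 * u) \<le> A / (real j + 1)" for j
    using le_sublinear_radius_iff[OF A u, of "S / 2" j] S by (simp add: R) linarith
  have half: "(S / 2) powr (2 * u) \<le> 1 / (1 + u)"
    by (rule half_radius_powr_le[OF S u])
  {
    case 0
    have "1 / (1 + u) \<le> 4 / u" using u by (simp add: field_simps)
    hence "S \<le> 2 * R 0" using half Au by (simp add: iff)
    thus ?case using s0 by simp
  next
    case (Suc k)
    hence IH: "s k \<le> 2 * R k" "s k \<le> S" and kK: "k < K" by auto
    from step[OF kK IH(2)] consider "s (Suc k) = 0" |
      "(s (Suc k))\<^sup>2 \<le> (s k)\<^sup>2 - \<tau> k * \<mu> / 2 * (sqrt 2 * s k) powr r + (\<tau> k)\<^sup>2 / 4"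
      by blast
    thus ?case
    proof cases
      case 1
      thus ?thesis using Rpos[of "Suc k"] S by simp
    next
      case 2
      show ?thesis
      proof (cases "S \<le> 2 * R (Suc k)")
        case True
        define a where "a = s k / S"
        define b where "b = \<mu>\<^sup>2 * S powr (2 * (r - 1))"
        have a: "0 \<le> a" "a \<le> 1" "s k = a * S"
          using S IH s0(1)[of k] by (auto simp: a_def)
        have "S\<^sup>2 \<le> 1\<^sup>2" using S by simp
        hence "S \<le> 1" by (rule power2_le_imp_le) simp
        hence "S powr (2 * (r - 1)) \<le> 1" using S r by (intro powr_le1) auto
        hence b: "0 \<le> b" "b \<le> 1" unfolding b_def using m by (auto intro: mult_le_one)
        have \<tau>S: "\<tau> k = \<mu> * S powr r" using \<tau>[OF kK] True by simp
        have "(s (Suc k))\<^sup>2 \<le> S\<^sup>2 * (a\<^sup>2 - b / 2 * (sqrt 2 * a) powr r + b / 4)"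
          using 2 step_bound_rescaled[OF a(1) S(1), of \<mu> r] unfolding \<tau>S a(3) b_def by simp
        also have "\<dots> \<le> S\<^sup>2 * 1"
          using scalar_bound_constant[OF a(1,2) b, of r] r by (intro mult_left_mono) auto
        finally have "(s (Suc k))\<^sup>2 \<le> S\<^sup>2" by simp
        hence "s (Suc k) \<le> S" by (rule power2_le_imp_le) (use S in simp)
        thus ?thesis using True by simp
      next
        case False
        define h where "h = 1 / (u * (real k + 1))"
        define a where "a = s k / R k"
        have a: "0 \<le> a" "a \<le> 2" "s k = a * R k"
          using Rpos[of k] IH s0(1)[of k] by (auto simp: a_def field_simps)
        \<comment> \<open>The decreasing bound has dropped below \<open>S\<close>, which forces \<open>u * (k + 1) \<ge> 4\<close>.\<close>
        have "4 / u / (real k + 2) \<le> A / (real k + 2)"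
          using Au by (intro divide_right_mono) auto
        also have "\<dots> < (S / 2) powr (2 * u)" using False by (simp add: iff add.commute)
        also note half
        finally have "4 / (u * (real k + 2)) < 1 / (1 + u)" by simp
        moreover have "0 < u * (real k + 2)" using u by simp
        moreover have "4 / w < 1 / (1 + u) \<Longrightarrow> 0 < w \<Longrightarrow> 4 * (1 + u) < w" for w
          using u by (simp add: field_simps)
        ultimately have "4 * (1 + u) < u * (real k + 2)" by blast
        hence "4 \<le> u * (real k + 1)" using u by (simp add: algebra_simps)
        hence h: "0 \<le> h" "h \<le> 1 / 4" unfolding h_def using u by (auto simp: field_simps)
        have b: "\<mu>\<^sup>2 * R k powr (2 * (r - 1)) = 4 * h"
          using m u sublinear_radius_powr[OF A u, of k]
          by (simp add: R A_def h_def flip: u_def)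
        have \<tau>R: "\<tau> k = \<mu> * R k powr r" using \<tau>[OF kK] False by simp
        have "(s (Suc k))\<^sup>2 \<le>
            (R k)\<^sup>2 * (a\<^sup>2 - (4 * h) / 2 * (sqrt 2 * a) powr r + (4 * h) / 4)"
          using 2 step_bound_rescaled[OF a(1) Rpos[of k], of \<mu> r] unfolding \<tau>R a(3) b by simp
        also have "\<dots> \<le> (R k)\<^sup>2 * (4 * (1 - h))"
          using scalar_bound_decreasing[OF a(1,2) h, of r] r by (intro mult_left_mono) auto
        also have "\<dots> = 4 * ((R k)\<^sup>2 * (1 - h))" by simp
        also have "\<dots> \<le> 4 * (R (Suc k))\<^sup>2"
          using sublinear_radius_Suc_ge[OF A u, of k]
          unfolding R h_def by (rule mult_left_mono) simp
        also have "\<dots> = (2 * R (Suc k))\<^sup>2" by (simp add: power_mult_distrib)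
        finally have "s (Suc k) \<le> 2 * R (Suc k)"
          by (rule power2_le_imp_le) (use Rpos[of "Suc k"] in simp)
        thus ?thesis using False by simp
      qed
    qed
  }
qed

text \<open>The index set \<open>k \<le> kbar - 1\<close> is where the bound for the next iterate, \<open>2 * R (Suc k)\<close>, is
  still at least \<open>S\<close>; the two copies of \<open>- 1\<close> account for \<open>real (Suc k) + 1 = real k + 2\<close>.\<close>

lemma le_switching_index_iff:
  fixes \<mu> r S :: real
  assumes "0 < \<mu>" "1 < r" "0 < S"
  shows "int k \<le> \<lfloor>4 / ((r - 1) * \<mu>\<^sup>2 * (S / 2) powr (2 * (r - 1)))\<rfloor> - 1 - 1 \<longleftrightarrow>
    S \<le> 2 * sublinear_radius (4 / (\<mu>\<^sup>2 * (r - 1))) (r - 1) (Suc k)"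
proof -
  define P where "P = (S / 2) powr (2 * (r - 1))"
  define c where "c = (r - 1) * \<mu>\<^sup>2"
  have P: "0 < P" using assms by (simp add: P_def)
  have c: "0 < c" using assms by (simp add: c_def)
  have "int k \<le> \<lfloor>4 / ((r - 1) * \<mu>\<^sup>2 * P)\<rfloor> - 1 - 1 \<longleftrightarrow> int k + 2 \<le> \<lfloor>4 / ((r - 1) * \<mu>\<^sup>2 * P)\<rfloor>"
    by linarith
  also have "\<dots> \<longleftrightarrow> real k + 2 \<le> 4 / ((r - 1) * \<mu>\<^sup>2 * P)"
    by (simp add: le_floor_iff)
  also have "\<dots> \<longleftrightarrow> (real k + 2) * (c * P) \<le> 4"
    unfolding c_def[symmetric] using c P by (intro pos_le_divide_eq) simp
  also have "\<dots> \<longleftrightarrow> P * (c * (real k + 2)) \<le> 4" by (simp add: mult_ac)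
  also have "\<dots> \<longleftrightarrow> P \<le> 4 / (c * (real k + 2))"
    using c by (intro pos_le_divide_eq[symmetric]) simp
  also have "\<dots> \<longleftrightarrow> P \<le> 4 / (\<mu>\<^sup>2 * (r - 1)) / (real (Suc k) + 1)"
    by (simp add: c_def mult_ac add_ac)
  also have "\<dots> \<longleftrightarrow> S / 2 \<le> sublinear_radius (4 / (\<mu>\<^sup>2 * (r - 1))) (r - 1) (Suc k)"
    unfolding P_def using assms by (intro le_sublinear_radius_iff[symmetric]) auto
  finally show ?thesis unfolding P_def by linarith
qed

section \<open>Convergence of Riemannian gradient descent\<close>

theorem proposition3p1:
  fixes xs :: "real ^ 'n" and x :: "nat \<Rightarrow> real ^ 'n" and g :: "real ^ 'n \<Rightarrow> real ^ 'n"
    and \<eta> :: "nat \<Rightarrow> real" and \<mu> r \<theta>bar :: real and K :: nat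
  assumes "xs \<in> sphere 0 1"
    and "r \<ge> 1"
    and "0 < \<mu>" and "\<mu> \<le> 1"
    and "0 < \<theta>bar" and "\<theta>bar < pi / 2"
    and "x 0 \<in> sphere 0 1"
    and "sphere_angle (x 0) xs \<le> \<theta>bar"
    and "tangent_vector_field g"
    and "rgd_iterates g \<eta> K x"
    and "\<forall>k\<le>K. RGA \<mu> r g (x k) xs"
  shows "(r = 1 \<and>
          (\<forall>k<K. \<eta> k = sin (\<theta>bar / 2) * \<mu> * (1 - \<mu>\<^sup>2 / 8) ^ k / norm (g (x k)))
          \<longrightarrow> (\<forall>k\<le>K. 1 / 2 * norm (x k - xs) = sin (sphere_angle (x k) xs / 2) \<and>
                sin (sphere_angle (x k) xs / 2)
                  \<le> sin (\<theta>bar / 2) * exp (- (\<mu>\<^sup>2 * real k / 8)))) \<and>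
         (let kbar = \<lfloor>4 / ((r - 1) * \<mu>\<^sup>2 * (sin (\<theta>bar / 2) / 2) powr (2 * (r - 1)))\<rfloor> - 1
          in r > 1 \<and>
             (\<forall>k<K. \<eta> k =
                (if int k \<le> kbar - 1
                 then \<mu> * sin (\<theta>bar / 2) powr r / norm (g (x k))
                 else (4 / (\<mu>\<^sup>2 * (r - 1) * (real k + 1))) powr (r / (2 * r - 2))
                        * (\<mu> / norm (g (x k)))))
             \<longrightarrow> (\<forall>k\<le>K. 1 / 2 * norm (x k - xs) = sin (sphere_angle (x k) xs / 2) \<and>
                   sin (sphere_angle (x k) xs / 2)
                     \<le> min (2 * (4 / (\<mu>\<^sup>2 * (r - 1)) * (1 / (real k + 1))) powr (1 / (2 * (r - 1))))
                           (sin (\<theta>bar / 2))))"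
proof -
  define S where "S = sin (\<theta>bar / 2)"
  define s where "s k = norm (x k - xs) / 2" for k
  have S0: "0 < S" unfolding S_def using assms(5,6) by (intro sin_gt_zero) auto
  have "S \<le> sin (pi / 4)" unfolding S_def using assms(5,6) by (subst sin_mono_le_eq) auto
  hence "S\<^sup>2 \<le> (sqrt 2 / 2)\<^sup>2" using S0 by (intro power_mono) (auto simp: sin_45)
  hence S2: "S\<^sup>2 \<le> 1 / 2" by (simp add: power_divide)
  have xs: "norm xs = 1" and x0: "norm (x 0) = 1" using assms(1,7) by auto
  have nx: "norm (x k) = 1" if "k \<le> K" for k
    using rgd_iterates_on_sphere[OF assms(10,9) x0 that] .
  have sin_half: "sin (sphere_angle (x k) xs / 2) = s k" if "k \<le> K" for k
    unfolding s_def by (rule sin_half_sphere_angle[OF nx[OF that] xs])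
  have s_nonneg: "0 \<le> s k" for k by (simp add: s_def)
  have s_init: "s 0 \<le> S"
  proof -
    have "\<bar>x 0 \<bullet> xs\<bar> \<le> 1" using Cauchy_Schwarz_ineq2[of "x 0" xs] x0 xs by simp
    hence "0 \<le> sphere_angle (x 0) xs"
      unfolding sphere_angle_def by (intro arccos_lbound) auto
    hence "sin (sphere_angle (x 0) xs / 2) \<le> sin (\<theta>bar / 2)"
      using assms(5,6,8) by (subst sin_mono_le_eq) auto
    thus ?thesis using sin_half[of 0] by (simp add: S_def)
  qed
  have step: "s (Suc k) = 0 \<or>
      (s (Suc k))\<^sup>2 \<le> (s k)\<^sup>2 - \<tau> k * \<mu> / 2 * (sqrt 2 * s k) powr r + (\<tau> k)\<^sup>2 / 4"
    if \<tau>: "\<forall>k<K. \<eta> k = \<tau> k / norm (g (x k))" "\<forall>k<K. 0 \<le> \<tau> k" and k: "k < K" and le: "s k \<le> S"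
    for \<tau> :: "nat \<Rightarrow> real" and k
  proof (cases "g (x k) = 0")
    case True
    have "RGA \<mu> r g (x k) xs" using assms(11) k by simp
    hence "x k = xs" using True unfolding RGA_def by blast
    moreover have "x (Suc k) = x k" using assms(10) k True by (simp add: rgd_iterates_def)
    ultimately show ?thesis by (simp add: s_def)
  next
    case False
    have "(s k)\<^sup>2 \<le> S\<^sup>2" using le s_nonneg by (intro power_mono) auto
    hence small: "(norm (x k - xs) / 2)\<^sup>2 \<le> 1 / 2" using S2 by (simp add: s_def)
    have tang: "g (x k) \<bullet> x k = 0"
      using assms(9) nx[of k] k
      by (auto simp: tangent_vector_field_def tangent_space_def orthogonal_def)
    have \<eta>0: "0 \<le> \<eta> k" using \<tau> k by simp
    have t: "\<eta> k * norm (g (x k)) = \<tau> k" using \<tau> k False by simp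
    have "RGA \<mu> r g (x k) xs" using assms(11) k by simp
    from rgd_step[OF nx xs tang this \<eta>0 _ _ small] show ?thesis
      using assms(2,3,10) k False by (simp add: rgd_iterates_def s_def t)
  qed
  have part1: "s k \<le> S * exp (- (\<mu>\<^sup>2 * real k / 8))"
    if r: "r = 1" and \<eta>: "\<forall>k<K. \<eta> k = S * \<mu> * (1 - \<mu>\<^sup>2 / 8) ^ k / norm (g (x k))"
      and k: "k \<le> K" for k
  proof -
    have q: "0 \<le> 1 - \<mu>\<^sup>2 / 8" using power_le_one[of \<mu> 2] assms(3,4) by simp
    define \<tau> where "\<tau> k = S * \<mu> * (1 - \<mu>\<^sup>2 / 8) ^ k" for k
    have \<eta>': "\<forall>k<K. \<eta> k = \<tau> k / norm (g (x k))" using \<eta> by (simp add: \<tau>_def)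
    have \<tau>0: "\<forall>k<K. 0 \<le> \<tau> k" using S0 assms(3) q by (simp add: \<tau>_def)
    have "s k \<le> S * (1 - \<mu>\<^sup>2 / 8) ^ k"
      by (rule linear_rate_recursion[where s = s and \<tau> = \<tau> and K = K,
            OF s_nonneg s_init S0 assms(3,4) step[OF \<eta>' \<tau>0, unfolded r] \<tau>_def k])
    also have "\<dots> \<le> S * exp (- (\<mu>\<^sup>2 / 8)) ^ k"
      using q S0 exp_ge_add_one_self[of "- (\<mu>\<^sup>2 / 8)"]
      by (intro mult_left_mono power_mono) auto
    also have "\<dots> = S * exp (- (\<mu>\<^sup>2 * real k / 8))"
      by (simp flip: exp_of_nat_mult add: mult_ac)
    finally show ?thesis .
  qed
  define R where "R = sublinear_radius (4 / (\<mu>\<^sup>2 * (r - 1))) (r - 1)"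
  define kbar where "kbar = \<lfloor>4 / ((r - 1) * \<mu>\<^sup>2 * (S / 2) powr (2 * (r - 1)))\<rfloor> - 1"
  have part2: "s k \<le> min (2 * R k) S"
    if r: "r > 1" and \<eta>: "\<forall>k<K. \<eta> k =
                (if int k \<le> kbar - 1
                 then \<mu> * S powr r / norm (g (x k))
                 else (4 / (\<mu>\<^sup>2 * (r - 1) * (real k + 1))) powr (r / (2 * r - 2))
                        * (\<mu> / norm (g (x k))))"
      and k: "k \<le> K" for k
  proof -
    define \<tau> where "\<tau> k = \<mu> * (if S \<le> 2 * R (Suc k) then S else R k) powr r" for k
    have "(4 / (\<mu>\<^sup>2 * (r - 1) * (real k + 1))) powr (r / (2 * r - 2)) = R k powr r" for k
    proof -
      have "1 / (2 * (r - 1)) * r = r / (2 * r - 2)" by (simp add: algebra_simps)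
      thus ?thesis by (simp add: R_def sublinear_radius_def powr_powr)
    qed
    moreover have "int k \<le> kbar - 1 \<longleftrightarrow> S \<le> 2 * R (Suc k)" for k
      unfolding kbar_def R_def by (rule le_switching_index_iff[OF assms(3) r S0])
    ultimately have \<eta>': "\<forall>k<K. \<eta> k = \<tau> k / norm (g (x k))"
      using \<eta> by (auto simp: \<tau>_def)
    have \<tau>0: "\<forall>k<K. 0 \<le> \<tau> k" using assms(3) by (simp add: \<tau>_def)
    show ?thesis unfolding R_def
      by (rule sublinear_rate_recursion[where s = s and \<tau> = \<tau> and K = K,
            OF s_nonneg s_init S0 S2 assms(3,4) r step[OF \<eta>' \<tau>0] \<tau>_def[unfolded R_def] k])
  qed
  have Rk: "(4 / (\<mu>\<^sup>2 * (r - 1)) * (1 / (real k + 1))) powr (1 / (2 * (r - 1))) = R k" for k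
    by (simp add: R_def sublinear_radius_def)
  show ?thesis
    unfolding Let_def Rk S_def[symmetric] kbar_def[symmetric]
  proof (intro conjI impI allI; elim conjE)
    fix k assume k: "k \<le> K"
    show "1 / 2 * norm (x k - xs) = sin (sphere_angle (x k) xs / 2)"
      using sin_half[OF k] by (simp add: s_def)
    show "1 / 2 * norm (x k - xs) = sin (sphere_angle (x k) xs / 2)"
      using sin_half[OF k] by (simp add: s_def)
  next
    fix k assume "k \<le> K" "r = 1"
      and "\<forall>k<K. \<eta> k = S * \<mu> * (1 - \<mu>\<^sup>2 / 8) ^ k / norm (g (x k))"
    thus "sin (sphere_angle (x k) xs / 2) \<le> S * exp (- (\<mu>\<^sup>2 * real k / 8))"
      using part1 by (simp add: sin_half)
  next
    fix k assume k: "k \<le> K" and "r > 1" and "\<forall>k<K. \<eta> k =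
                (if int k \<le> kbar - 1
                 then \<mu> * S powr r / norm (g (x k))
                 else (4 / (\<mu>\<^sup>2 * (r - 1) * (real k + 1))) powr (r / (2 * r - 2))
                        * (\<mu> / norm (g (x k))))"
    from part2[OF this(2,3) k]
    show "sin (sphere_angle (x k) xs / 2) \<le> min (2 * R k) S"
      unfolding sin_half[OF k] .
  qed
qed

end
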